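(* Let $H$ be a grid subgraph on $r$ rows and $c$ columns which can be obtained (up to relabeling rows and columns) by finitely many row/column-bridging operations starting from the grid subgraph consisting of a single vertex (one row, one column, no edges). Then $\operatorname{gr}(H,K_k)=k^{O(2^{r+c})}$; explicitly, $\operatorname{gr}(H,K_k)\le 2^{2^{r+c}-2}k^{2^{r+c-3}}$ for all $k\ge 1$.
   Context: A grid subgraph on $c$ columns and $r$ rows is a graph whose vertex set is a subset of $[c]\times[r]$ (vertex $(x,y)$ in column $x$, row $y$) and whose edges each join two vertices in the same row or in the same column. $G_{N\times N}=K_N\square K_N$; a spanning grid subgraph is a spanning subgraph of it. An embedding of $H$ (on $c_H$ columns, $r_H$ rows) into $G$ is a pair of injections $\varphi_c:[c_H]\to[c_G]$, $\varphi_r:[r_H]\to[r_G]$ sending every edge $\{(x,y),(x',y')\}$ of $H$ to an edge $\{(\varphi_c(x),\varphi_r(y)),(\varphi_c(x'),\varphi_r(y'))\}$ of $G$; $G$ contains $H$ if one exists. A coclique of size $k$ is a set of $k$ pairwise non-adjacent vertices all in one row or all in one column. $\operatorname{gr}(H,K_k)$ is the least $N$ such that every spanning grid subgraph of $G_{N\times N}$ contains $H$ or a coclique of size $k$. Column-bridging: for $H$ on $c$ columns and $r$ rows, $c_*\in[c]$, $y\in[r]$, bridging column $c_*$ at row $y$ yields $H'$ on $c+1$ columns and $r$ rows with edges: all edges of $H$; $\{(a,b),(c+1,b)\}$ whenever $\{(a,b),(c_*,b)\}\in E(H)$; $\{(c+1,b),(c+1,e)\}$ whenever $\{(c_*,b),(c_*,e)\}\in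 E(H)$; and $\{(c_*,y),(c+1,y)\}$. Row-bridging is defined analogously with rows and columns exchanged. *)

theory Defs
  imports Complex_Main
begin

record grid_graph =
  ncols :: nat
  nrows :: nat
  gverts :: "(nat \<times> nat) set"
  gedges :: "(nat \<times> nat) set set"

definition grid_subgraph :: "grid_graph \<Rightarrow> bool" where
  "grid_subgraph G \<longleftrightarrow>
     gverts G \<subseteq> {1..ncols G} \<times> {1..nrows G} \<and>
     (\<forall>e\<in>gedges G. \<exists>u v. e = {u, v} \<and> u \<noteq> v \<and> u \<in> gverts G \<and> v \<in> gverts G \<and>
        (fst u = fst v \<or> snd u = snd v))"

text \<open>The rook's graph: the Cartesian product of two complete graphs on \<open>N\<close> vertices.\<close>

definition complete_grid :: "nat \<Rightarrow> grid_graph" where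
  "complete_grid N =
     \<lparr> ncols = N, nrows = N, gverts = {1..N} \<times> {1..N},
       gedges = {{u, v} | u v. u \<in> {1..N} \<times> {1..N} \<and> v \<in> {1..N} \<times> {1..N} \<and> u \<noteq> v \<and>
                   (fst u = fst v \<or> snd u = snd v)} \<rparr>"

definition spanning_grid_subgraph :: "nat \<Rightarrow> grid_graph \<Rightarrow> bool" where
  "spanning_grid_subgraph N G \<longleftrightarrow>
     ncols G = N \<and> nrows G = N \<and>
     gverts G = gverts (complete_grid N) \<and> gedges G \<subseteq> gedges (complete_grid N)"

definition grid_embedding :: "grid_graph \<Rightarrow> grid_graph \<Rightarrow> (nat \<Rightarrow> nat) \<Rightarrow> (nat \<Rightarrow> nat) \<Rightarrow> bool" where
  "grid_embedding H G \<phi>c \<phi>r \<longleftrightarrow>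
     \<phi>c ` {1..ncols H} \<subseteq> {1..ncols G} \<and> inj_on \<phi>c {1..ncols H} \<and>
     \<phi>r ` {1..nrows H} \<subseteq> {1..nrows G} \<and> inj_on \<phi>r {1..nrows H} \<and>
     (\<forall>x y x' y'. {(x, y), (x', y')} \<in> gedges H \<longrightarrow>
        {(\<phi>c x, \<phi>r y), (\<phi>c x', \<phi>r y')} \<in> gedges G)"

definition grid_contains :: "grid_graph \<Rightarrow> grid_graph \<Rightarrow> bool" where
  "grid_contains G H \<longleftrightarrow> (\<exists>\<phi>c \<phi>r. grid_embedding H G \<phi>c \<phi>r)"

definition grid_coclique :: "grid_graph \<Rightarrow> nat \<Rightarrow> (nat \<times> nat) set \<Rightarrow> bool" where
  "grid_coclique G k S \<longleftrightarrow>
     S \<subseteq> gverts G \<and> finite S \<and> card S = k \<and>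
     (\<forall>u\<in>S. \<forall>v\<in>S. u \<noteq> v \<longrightarrow> {u, v} \<notin> gedges G) \<and>
     ((\<exists>x. \<forall>v\<in>S. fst v = x) \<or> (\<exists>y. \<forall>v\<in>S. snd v = y))"

definition grid_ramsey_property :: "grid_graph \<Rightarrow> nat \<Rightarrow> nat \<Rightarrow> bool" where
  "grid_ramsey_property H k N \<longleftrightarrow>
     (\<forall>G. spanning_grid_subgraph N G \<longrightarrow> grid_contains G H \<or> (\<exists>S. grid_coclique G k S))"

definition gr :: "grid_graph \<Rightarrow> nat \<Rightarrow> nat" where
  "gr H k = (LEAST N. grid_ramsey_property H k N)"

text \<open>Bridging duplicates the vertices of the bridged line along with its edges. Adding the two
  ends of the bridge explicitly only matters if the bridged position is not a vertex, which never
  happens for graphs built from a single vertex.\<close>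

definition bridge_column :: "nat \<Rightarrow> nat \<Rightarrow> grid_graph \<Rightarrow> grid_graph" where
  "bridge_column cs y H = (let c = ncols H in
     \<lparr> ncols = c + 1, nrows = nrows H,
       gverts = gverts H \<union> {(c + 1, b) | b. (cs, b) \<in> gverts H} \<union> {(cs, y), (c + 1, y)},
       gedges = gedges H
         \<union> {{(a, b), (c + 1, b)} | a b. {(a, b), (cs, b)} \<in> gedges H}
         \<union> {{(c + 1, b), (c + 1, e)} | b e. {(cs, b), (cs, e)} \<in> gedges H}
         \<union> {{(cs, y), (c + 1, y)}} \<rparr>)"

definition bridge_row :: "nat \<Rightarrow> nat \<Rightarrow> grid_graph \<Rightarrow> grid_graph" where
  "bridge_row rs x H = (let r = nrows H in
     \<lparr> ncols = ncols H, nrows = r + 1,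
       gverts = gverts H \<union> {(a, r + 1) | a. (a, rs) \<in> gverts H} \<union> {(x, rs), (x, r + 1)},
       gedges = gedges H
         \<union> {{(a, b), (a, r + 1)} | a b. {(a, b), (a, rs)} \<in> gedges H}
         \<union> {{(a, r + 1), (d, r + 1)} | a d. {(a, rs), (d, rs)} \<in> gedges H}
         \<union> {{(x, rs), (x, r + 1)}} \<rparr>)"

definition single_vertex :: grid_graph where
  "single_vertex = \<lparr> ncols = 1, nrows = 1, gverts = {(1, 1)}, gedges = {} \<rparr>"

inductive bridged :: "grid_graph \<Rightarrow> bool" where
  base: "bridged single_vertex"
| column: "\<lbrakk> bridged H; cs \<in> {1..ncols H}; y \<in> {1..nrows H} \<rbrakk> \<Longrightarrow> bridged (bridge_column cs y H)"
| row: "\<lbrakk> bridged H; rs \<in> {1..nrows H}; x \<in> {1..ncols H} \<rbrakk> \<Longrightarrow> bridged (bridge_row rs x H)"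

definition grid_relabeling :: "grid_graph \<Rightarrow> grid_graph \<Rightarrow> bool" where
  "grid_relabeling H H' \<longleftrightarrow>
     ncols H' = ncols H \<and> nrows H' = nrows H \<and>
     (\<exists>p q. bij_betw p {1..ncols H} {1..ncols H} \<and> bij_betw q {1..nrows H} {1..nrows H} \<and>
        gverts H' = map_prod p q ` gverts H \<and>
        gedges H' = (\<lambda>e. map_prod p q ` e) ` gedges H)"

definition bridging_constructible :: "grid_graph \<Rightarrow> bool" where
  "bridging_constructible H \<longleftrightarrow> (\<exists>H0. bridged H0 \<and> grid_relabeling H0 H)"

end

theory Submission
  imports Defs "HOL-Library.FuncSet"
begin

text \<open>Let \<open>G\<close> be an \<open>M \<times> M\<close> grid without a coclique of size \<open>k\<close>, let \<open>T(H)\<close> be the number of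
  embeddings into \<open>G\<close> of a grid subgraph \<open>H\<close> with \<open>n\<close> rows and columns in total, and let \<open>H'\<close>
  arise from \<open>H\<close> by bridging a column. Two embeddings of \<open>H\<close> that differ only in the image of the
  bridged column, and send it to two columns adjacent in the image of the bridging row, combine
  to an embedding of \<open>H'\<close>. Among the embeddings with fixed values off the bridged column, any
  \<open>k\<close> contain such a pair, since that row has no coclique of size \<open>k\<close>. Hence a set of embeddings
  without such a pair has at most \<open>k M^(n-1)\<close> elements, and Turan's bound for the graph on all
  embeddings gives \<open>T(H)^2 \<le> k M^(n-1) (T(H') + T(H))\<close>. In terms of the densities
  \<open>d(H) = T(H) / M^n\<close> this reads \<open>d(H)^2 \<le> k (d(H') + d(H) / M)\<close>, so that
  \<open>d(H') \<ge> d(H)^2 / (2 k)\<close> as long as \<open>M \<ge> 2 k / d(H)\<close>. Starting from density \<open>1\<close> for the single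
  vertex, \<open>M = (2 k)^(2^(n-3))\<close> suffices to reach every \<open>H\<close> with \<open>n \<ge> 3\<close>. Rows are handled by
  transposition.\<close>

subsection \<open>Turan's bound\<close>

lemma power2_add_le_weighted:
  fixes a b c k :: "'a::linordered_field"
  assumes b: "b\<^sup>2 \<le> k * c" and k: "0 \<le> k" and c: "0 \<le> c"
  shows "(a + b)\<^sup>2 \<le> (k + 1) * (a\<^sup>2 + c)"
proof (cases "k = 0")
  case True
  with b have "b = 0" by simp
  with True c show ?thesis by simp
next
  case False
  with k have "0 < k" by simp
  have "k * (2 * a * b) \<le> (k * a)\<^sup>2 + b\<^sup>2"
    using sum_squares_bound[of "k * a" b] by (simp add: mult_ac)
  also have "\<dots> \<le> k * (k * a\<^sup>2 + c)"
    using b by (simp add: power2_eq_square algebra_simps)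
  finally have "2 * a * b \<le> k * a\<^sup>2 + c" using \<open>0 < k\<close> by simp
  with b show ?thesis by (simp add: power2_sum algebra_simps)
qed

definition closed_nbhd :: "('a \<Rightarrow> 'a \<Rightarrow> bool) \<Rightarrow> 'a set \<Rightarrow> 'a \<Rightarrow> 'a set" where
  "closed_nbhd R A a = {b \<in> A. R a b}"

lemma card_power2_le_remove_min_closed_nbhd:
  assumes A: "finite A" and B: "B = A - closed_nbhd R A v"
    and min: "\<And>a. a \<in> A \<Longrightarrow> card (closed_nbhd R A v) \<le> card (closed_nbhd R A a)"
    and card_B: "(real (card B))\<^sup>2 \<le> real k * (\<Sum>a\<in>B. real (card (closed_nbhd R B a)))"
  shows "(real (card A))\<^sup>2 \<le> real (Suc k) * (\<Sum>a\<in>A. real (card (closed_nbhd R A a)))"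
proof -
  let ?N = "closed_nbhd R A v" and ?deg = "\<lambda>A a. real (card (closed_nbhd R A a))"
  have N: "?N \<subseteq> A" "finite ?N" using A by (auto simp: closed_nbhd_def)
  have deg_N: "(real (card ?N))\<^sup>2 \<le> sum (?deg A) ?N"
    using N(1) min by (auto simp: power2_eq_square intro!: sum_bounded_below)
  have deg_B: "sum (?deg B) B \<le> sum (?deg A) B"
    using A by (intro sum_mono of_nat_mono card_mono) (auto simp: closed_nbhd_def B)
  have "card A = card ?N + card B"
    using card_Diff_subset[OF N(2,1)] card_mono[OF A N(1)] by (simp add: B)
  then have "(real (card A))\<^sup>2 = (real (card ?N) + real (card B))\<^sup>2" by simp
  also have "\<dots> \<le> (real k + 1) * ((real (card ?N))\<^sup>2 + sum (?deg B) B)"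
    using card_B by (rule power2_add_le_weighted) (auto intro: sum_nonneg)
  also have "\<dots> \<le> (real k + 1) * (sum (?deg A) ?N + sum (?deg A) B)"
    using deg_N deg_B by (intro mult_left_mono add_mono) auto
  also have "\<dots> = real (Suc k) * sum (?deg A) A"
    using sum.subset_diff[OF N(1) A, of "?deg A"] by (simp add: B algebra_simps)
  finally show ?thesis .
qed

lemma Turan_card_power2_le:
  assumes "finite A" "reflp_on A R" "symp_on A R"
    and "\<And>S. S \<subseteq> A \<Longrightarrow> pairwise (\<lambda>a b. \<not> R a b) S \<Longrightarrow> card S \<le> k"
  shows "(real (card A))\<^sup>2 \<le> real k * (\<Sum>a\<in>A. real (card (closed_nbhd R A a)))"
  using assms
proof (induction k arbitrary: A)
  case 0
  have "v \<notin> A" for v using "0.prems"(4)[of "{v}"] by auto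
  then have "A = {}" by blast
  then show ?case by simp
next
  case (Suc k)
  show ?case
  proof (cases "A = {}")
    case False
    obtain v where v: "v \<in> A"
      and min: "\<And>a. a \<in> A \<Longrightarrow> card (closed_nbhd R A v) \<le> card (closed_nbhd R A a)"
      using arg_min_if_finite[OF \<open>finite A\<close> False, of "\<lambda>a. card (closed_nbhd R A a)"]
      by (meson not_le)
    define B where "B = A - closed_nbhd R A v"
    have B: "B \<subseteq> A" "finite B" using \<open>finite A\<close> by (auto simp: B_def)
    have "(real (card B))\<^sup>2 \<le> real k * (\<Sum>a\<in>B. real (card (closed_nbhd R B a)))"
    proof (rule Suc.IH)
      show "reflp_on B R" "symp_on B R"
        using Suc.prems(2,3) B(1) by (auto intro: reflp_on_subset symp_on_subset)
      fix S assume S: "S \<subseteq> B" "pairwise (\<lambda>a b. \<not> R a b) S"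
      have "v \<notin> S"
        using S(1) v reflp_onD[OF Suc.prems(2)] by (auto simp: B_def closed_nbhd_def)
      moreover have "pairwise (\<lambda>a b. \<not> R a b) (insert v S)"
        using S v symp_onD[OF Suc.prems(3), of _ v]
        by (auto simp: pairwise_insert B_def closed_nbhd_def)
      then have "card (insert v S) \<le> Suc k" using S(1) B(1) v by (intro Suc.prems(4)) auto
      ultimately show "card S \<le> k" using finite_subset[OF S(1) B(2)] by simp
    qed (fact B(2))
    then show ?thesis
      by (intro card_power2_le_remove_min_closed_nbhd[OF \<open>finite A\<close> B_def min])
  qed simp
qed

subsection \<open>Grid subgraphs, transposition and bridging\<close>

definition grid_edges :: "(nat \<times> nat) set \<Rightarrow> (nat \<times> nat) set set" where
  "grid_edges V = {{u, v} | u v. u \<in> V \<and> v \<in> V \<and> u \<noteq> v \<and> (fst u = fst v \<or> snd u = snd v)}"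

lemma grid_subgraph_iff:
  "grid_subgraph H \<longleftrightarrow>
    gverts H \<subseteq> {1..ncols H} \<times> {1..nrows H} \<and> gedges H \<subseteq> grid_edges (gverts H)"
  unfolding grid_subgraph_def grid_edges_def by blast

lemma doubleton_mem_grid_edges [simp]:
  "{u, v} \<in> grid_edges V \<longleftrightarrow> u \<in> V \<and> v \<in> V \<and> u \<noteq> v \<and> (fst u = fst v \<or> snd u = snd v)"
  by (auto simp: grid_edges_def doubleton_eq_iff simp del: split_paired_Ex)

lemma grid_edges_mono: "V \<subseteq> W \<Longrightarrow> grid_edges V \<subseteq> grid_edges W"
  unfolding grid_edges_def by blast

lemma swap_image_mem_grid_edges:
  assumes "e \<in> grid_edges V"
  shows "prod.swap ` e \<in> grid_edges (prod.swap ` V)"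
proof -
  obtain u v where "e = {u, v}" "u \<in> V" "v \<in> V" "u \<noteq> v" "fst u = fst v \<or> snd u = snd v"
    using assms unfolding grid_edges_def by blast
  moreover from \<open>u \<noteq> v\<close> have "prod.swap u \<noteq> prod.swap v" by (metis swap_swap)
  ultimately show ?thesis by auto
qed

lemma gvertsD:
  assumes "grid_subgraph H" "(a, b) \<in> gverts H"
  shows "a \<in> {1..ncols H}" "b \<in> {1..nrows H}"
  using assms unfolding grid_subgraph_iff by blast+

lemma doubleton_gedgesD:
  assumes "grid_subgraph H" "{u, v} \<in> gedges H"
  shows "u \<in> gverts H" "v \<in> gverts H" "u \<noteq> v" "fst u = fst v \<or> snd u = snd v"
proof -
  have "{u, v} \<in> grid_edges (gverts H)" using assms unfolding grid_subgraph_iff by blast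
  then show "u \<in> gverts H" "v \<in> gverts H" "u \<noteq> v" "fst u = fst v \<or> snd u = snd v"
    by simp_all
qed

lemma gedgesE:
  assumes "grid_subgraph H" "e \<in> gedges H"
  obtains a b a' b' where "e = {(a, b), (a', b')}"
    "a \<in> {1..ncols H}" "b \<in> {1..nrows H}" "a' \<in> {1..ncols H}" "b' \<in> {1..nrows H}"
proof -
  obtain u v where e: "e = {u, v}" using assms unfolding grid_subgraph_iff grid_edges_def by blast
  with assms(2) have "{u, v} \<in> gedges H" by simp
  from doubleton_gedgesD(1,2)[OF assms(1) this] show thesis
    using gvertsD[OF assms(1)] by (cases u; cases v) (intro that; simp add: e)
qed

definition transpose_grid :: "grid_graph \<Rightarrow> grid_graph" where
  "transpose_grid H = \<lparr> ncols = nrows H, nrows = ncols H,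
     gverts = prod.swap ` gverts H, gedges = (`) prod.swap ` gedges H \<rparr>"

lemma transpose_grid_sel [simp]:
  "ncols (transpose_grid H) = nrows H" "nrows (transpose_grid H) = ncols H"
  "gverts (transpose_grid H) = prod.swap ` gverts H"
  "gedges (transpose_grid H) = (`) prod.swap ` gedges H"
  by (simp_all add: transpose_grid_def)

lemma transpose_grid_transpose_grid [simp]: "transpose_grid (transpose_grid H) = H"
  by (simp add: transpose_grid_def image_image)

lemma swap_image_mem_iff:
  fixes E :: "('a \<times> 'b) set set"
  shows "prod.swap ` e \<in> (`) prod.swap ` E \<longleftrightarrow> e \<in> E"
proof -
  have "inj ((`) (prod.swap :: 'a \<times> 'b \<Rightarrow> _))"
    by (rule inj_on_inverseI[where g = "(`) prod.swap"]) (simp add: image_image)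
  then show ?thesis by (rule inj_image_mem_iff)
qed

lemma doubleton_mem_swap_image_iff [simp]:
  "{(a, b), (c, d)} \<in> (`) prod.swap ` E \<longleftrightarrow> {(b, a), (d, c)} \<in> E"
  using swap_image_mem_iff[of "{(b, a), (d, c)}" E] by simp

lemma grid_subgraph_transpose:
  "grid_subgraph H \<Longrightarrow> grid_subgraph (transpose_grid H)"
  by (auto simp: grid_subgraph_iff intro!: swap_image_mem_grid_edges)

lemma bridge_column_sel [simp]:
  "ncols (bridge_column cs y H) = ncols H + 1" "nrows (bridge_column cs y H) = nrows H"
  by (simp_all add: bridge_column_def Let_def)

lemma bridge_row_sel [simp]:
  "ncols (bridge_row rs x H) = ncols H" "nrows (bridge_row rs x H) = nrows H + 1"
  by (simp_all add: bridge_row_def Let_def)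

lemma gedges_bridge_columnE [consumes 1, case_names old row_edge column_edge bridge]:
  assumes "e \<in> gedges (bridge_column cs y H)"
  obtains "e \<in> gedges H"
  | a b where "e = {(a, b), (ncols H + 1, b)}" "{(a, b), (cs, b)} \<in> gedges H"
  | b d where "e = {(ncols H + 1, b), (ncols H + 1, d)}" "{(cs, b), (cs, d)} \<in> gedges H"
  | "e = {(cs, y), (ncols H + 1, y)}"
  using assms unfolding bridge_column_def Let_def by auto

lemma bridge_row_eq_transpose:
  "bridge_row rs x H = transpose_grid (bridge_column rs x (transpose_grid H))"
proof -
  let ?T = "transpose_grid H"
  have image_swap: "(`) prod.swap ` {F a b | a b. P a b} = {prod.swap ` F a b | a b. P a b}"
    for F :: "nat \<Rightarrow> nat \<Rightarrow> (nat \<times> nat) set" and P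
    by blast
  have swap_row_edges:
    "(`) prod.swap ` {{(a, b), (n, b)} | a b. {(a, b), (rs, b)} \<in> gedges ?T} =
      {{(a, b), (a, n)} | a b. {(a, b), (a, rs)} \<in> gedges H}" for n :: nat
    unfolding image_swap by auto
  have swap_column_edges:
    "(`) prod.swap ` {{(n, b), (n, d)} | b d. {(rs, b), (rs, d)} \<in> gedges ?T} =
      {{(b, n), (d, n)} | b d. {(b, rs), (d, rs)} \<in> gedges H}" for n :: nat
    unfolding image_swap by simp
  have "gverts (bridge_row rs x H) = prod.swap ` gverts (bridge_column rs x ?T)"
    by (simp add: set_eq_iff bridge_row_def bridge_column_def Let_def)
  moreover have "gedges (bridge_row rs x H) = (`) prod.swap ` gedges (bridge_column rs x ?T)"
    unfolding bridge_row_def bridge_column_def Let_def grid_graph.simps image_Un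
      swap_row_edges swap_column_edges
    by (simp add: image_image)
  ultimately show ?thesis
    by (simp add: transpose_grid_def bridge_row_def Let_def)
qed

lemma grid_subgraph_bridge_column:
  assumes H: "grid_subgraph H" and cs: "cs \<in> {1..ncols H}" and y: "y \<in> {1..nrows H}"
  shows "grid_subgraph (bridge_column cs y H)"
  unfolding grid_subgraph_iff
proof
  let ?H = "bridge_column cs y H"
  have gverts: "gverts ?H =
      gverts H \<union> {(ncols H + 1, b) | b. (cs, b) \<in> gverts H} \<union> {(cs, y), (ncols H + 1, y)}"
    by (simp add: bridge_column_def Let_def)
  show "gverts ?H \<subseteq> {1..ncols ?H} \<times> {1..nrows ?H}"
    using H cs y by (auto simp: gverts grid_subgraph_iff)
  show "gedges ?H \<subseteq> grid_edges (gverts ?H)"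
  proof
    fix e assume "e \<in> gedges ?H"
    then show "e \<in> grid_edges (gverts ?H)"
    proof (cases rule: gedges_bridge_columnE)
      case old
      then show ?thesis
        using H grid_edges_mono[of "gverts H" "gverts ?H"] by (auto simp: grid_subgraph_iff gverts)
    next
      case (row_edge a b)
      then show ?thesis
        using doubleton_gedgesD[OF H row_edge(2)] gvertsD[OF H, of a b] by (simp add: gverts)
    next
      case (column_edge b d)
      then show ?thesis using doubleton_gedgesD[OF H column_edge(2)] by (simp add: gverts)
    next
      case bridge
      then show ?thesis using cs by (simp add: gverts)
    qed
  qed
qed

lemma bridged_grid_subgraph: "bridged H \<Longrightarrow> grid_subgraph H"
proof (induction rule: bridged.induct)
  case base
  show ?case by (simp add: grid_subgraph_def single_vertex_def)
next
  case (column H cs y)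
  then show ?case by (intro grid_subgraph_bridge_column)
next
  case (row H rs x)
  then show ?case
    unfolding bridge_row_eq_transpose
    by (intro grid_subgraph_transpose grid_subgraph_bridge_column) simp_all
qed

lemma bridged_dims_pos: "bridged H \<Longrightarrow> 1 \<le> ncols H \<and> 1 \<le> nrows H"
  by (induction rule: bridged.induct) (auto simp: single_vertex_def)

subsection \<open>Embeddings\<close>

lemma grid_embeddingI:
  assumes "f ` {1..ncols H} \<subseteq> {1..ncols G}" "inj_on f {1..ncols H}"
    and "g ` {1..nrows H} \<subseteq> {1..nrows G}" "inj_on g {1..nrows H}"
    and edges: "\<And>e. e \<in> gedges H \<Longrightarrow> map_prod f g ` e \<in> gedges G"
  shows "grid_embedding H G f g"
  unfolding grid_embedding_def using assms(1-4) edges[of "{(x, y), (x', y')}" for x y x' y'] by simp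

lemma grid_embedding_image_edge:
  assumes H: "grid_subgraph H" and emb: "grid_embedding H G f g" and e: "e \<in> gedges H"
  shows "map_prod f g ` e \<in> gedges G"
proof -
  obtain a b a' b' where "e = {(a, b), (a', b')}" using gedgesE[OF H e] by metis
  with emb e show ?thesis by (simp add: grid_embedding_def)
qed

lemma map_prod_image_edge_bridge_column:
  assumes H: "grid_subgraph H" and cs: "cs \<in> {1..ncols H}"
    and f: "grid_embedding H G f g" and f_upd: "grid_embedding H G (f(cs := b)) g"
    and adj: "{(f cs, g y), (b, g y)} \<in> gedges G"
    and e: "e \<in> gedges (bridge_column cs y H)"
  shows "map_prod (f(ncols H + 1 := b)) g ` e \<in> gedges G"
  using e
proof (cases rule: gedges_bridge_columnE)
  case old
  obtain p q p' q' where "e = {(p, q), (p', q')}" "p \<in> {1..ncols H}" "p' \<in> {1..ncols H}"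
    using gedgesE[OF H old] by metis
  then have "map_prod (f(ncols H + 1 := b)) g ` e = map_prod f g ` e" by auto
  then show ?thesis using grid_embedding_image_edge[OF H f old] by simp
next
  case (row_edge p q)
  have "p \<in> {1..ncols H}" "p \<noteq> cs"
    using doubleton_gedgesD[OF H row_edge(2)] gvertsD[OF H] by auto
  then show ?thesis
    using grid_embedding_image_edge[OF H f_upd row_edge(2)] by (simp add: row_edge(1))
next
  case (column_edge q q')
  then show ?thesis using grid_embedding_image_edge[OF H f_upd column_edge(2)] by simp
next
  case bridge
  then show ?thesis using adj cs by simp
qed

lemma inj_on_fun_upd_notin_image:
  assumes "inj_on (f(a := b)) A" "a \<in> A" "f a \<noteq> b"
  shows "b \<notin> f ` A"
proof
  assume "b \<in> f ` A"
  then obtain x where x: "x \<in> A" "f x = b" by blast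
  with assms(3) have "x \<noteq> a" by auto
  with x have "(f(a := b)) x = (f(a := b)) a" by simp
  with assms(1,2) x(1) \<open>x \<noteq> a\<close> show False by (meson inj_onD)
qed

lemma grid_embedding_bridge_column:
  assumes H: "grid_subgraph H" and cs: "cs \<in> {1..ncols H}"
    and f: "grid_embedding H G f g" and f_upd: "grid_embedding H G (f(cs := b)) g"
    and b: "f cs \<noteq> b" and adj: "{(f cs, g y), (b, g y)} \<in> gedges G"
  shows "grid_embedding (bridge_column cs y H) G (f(ncols H + 1 := b)) g"
proof (rule grid_embeddingI)
  let ?f' = "f(ncols H + 1 := b)"
  have cols: "{1..ncols (bridge_column cs y H)} = insert (ncols H + 1) {1..ncols H}" by auto
  have image_f': "?f' ` {1..ncols H} = f ` {1..ncols H}" by (intro image_cong) simp_all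
  have "b \<in> {1..ncols G}"
    using f_upd cs unfolding grid_embedding_def by (metis fun_upd_same image_subset_iff)
  then show "?f' ` {1..ncols (bridge_column cs y H)} \<subseteq> {1..ncols G}"
    unfolding cols image_insert image_f' using f by (simp add: grid_embedding_def)
  have inj: "inj_on f {1..ncols H}" "inj_on (f(cs := b)) {1..ncols H}"
    using f f_upd by (simp_all add: grid_embedding_def)
  have notin: "b \<notin> f ` {1..ncols H}" using inj(2) cs b by (rule inj_on_fun_upd_notin_image)
  have "?f' ` ({1..ncols H} - {ncols H + 1}) = f ` {1..ncols H}"
    by (intro image_cong) auto
  with inj_on_fun_updI[OF inj(1) notin] notin
  show "inj_on ?f' {1..ncols (bridge_column cs y H)}"
    unfolding cols inj_on_insert by simp
  show "g ` {1..nrows (bridge_column cs y H)} \<subseteq> {1..nrows G}"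
    "inj_on g {1..nrows (bridge_column cs y H)}"
    using f by (simp_all add: grid_embedding_def)
qed (rule map_prod_image_edge_bridge_column[OF H cs f f_upd adj])

type_synonym grid_map = "(nat \<Rightarrow> nat) \<times> (nat \<Rightarrow> nat)"

definition embeddings :: "grid_graph \<Rightarrow> grid_graph \<Rightarrow> grid_map set" where
  "embeddings H G = {(f, g). f \<in> extensional {1..ncols H} \<and> g \<in> extensional {1..nrows H} \<and>
     grid_embedding H G f g}"

lemma embeddings_subset:
  "embeddings H G \<subseteq> ({1..ncols H} \<rightarrow>\<^sub>E {1..ncols G}) \<times> ({1..nrows H} \<rightarrow>\<^sub>E {1..nrows G})"
  by (auto simp: embeddings_def grid_embedding_def PiE_def)

lemma embeddings_range:
  assumes "u \<in> embeddings H G"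
  shows "a \<in> {1..ncols H} \<Longrightarrow> fst u a \<in> {1..ncols G}"
    and "b \<in> {1..nrows H} \<Longrightarrow> snd u b \<in> {1..nrows G}"
proof -
  have "u \<in> ({1..ncols H} \<rightarrow>\<^sub>E {1..ncols G}) \<times> ({1..nrows H} \<rightarrow>\<^sub>E {1..nrows G})"
    using assms embeddings_subset by blast
  then have fst: "fst u \<in> {1..ncols H} \<rightarrow>\<^sub>E {1..ncols G}"
    and snd: "snd u \<in> {1..nrows H} \<rightarrow>\<^sub>E {1..nrows G}"
    by (simp_all only: mem_Times_iff)
  show "a \<in> {1..ncols H} \<Longrightarrow> fst u a \<in> {1..ncols G}" by (rule PiE_mem[OF fst])
  show "b \<in> {1..nrows H} \<Longrightarrow> snd u b \<in> {1..nrows G}" by (rule PiE_mem[OF snd])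
qed

lemma finite_embeddings: "finite (embeddings H G)"
  by (rule finite_subset[OF embeddings_subset]) (simp add: finite_PiE)

lemma grid_embedding_transpose:
  "grid_embedding (transpose_grid H) (transpose_grid G) g f \<longleftrightarrow> grid_embedding H G f g"
  unfolding grid_embedding_def by auto

lemma card_embeddings_transpose:
  "card (embeddings (transpose_grid H) (transpose_grid G)) = card (embeddings H G)"
proof -
  have "embeddings (transpose_grid H) (transpose_grid G) = prod.swap ` embeddings H G"
    by (force simp: embeddings_def grid_embedding_transpose)
  then show ?thesis by (simp add: card_image)
qed

definition coclique_free_grid :: "nat \<Rightarrow> grid_graph \<Rightarrow> bool" where
  "coclique_free_grid k G \<longleftrightarrow>
     gverts G = {1..ncols G} \<times> {1..nrows G} \<and> (\<nexists>S. grid_coclique G k S)"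

lemma grid_coclique_shrink:
  assumes "grid_coclique G m S" "k \<le> m"
  shows "\<exists>S'. grid_coclique G k S'"
proof -
  obtain S' where "S' \<subseteq> S" "card S' = k" "finite S'"
    using assms by (metis grid_coclique_def obtain_subset_with_card_n)
  with assms(1) have "grid_coclique G k S'" unfolding grid_coclique_def by blast
  then show ?thesis ..
qed

lemma grid_coclique_transpose:
  assumes S: "grid_coclique (transpose_grid G) k S"
  shows "grid_coclique G k (prod.swap ` S)"
proof -
  have "{prod.swap u, prod.swap v} \<notin> gedges G" if "u \<in> S" "v \<in> S" "u \<noteq> v" for u v
    using S that swap_image_mem_iff[of "{prod.swap u, prod.swap v}" "gedges G"]
    by (simp add: grid_coclique_def)
  moreover have "prod.swap ` S \<subseteq> gverts G"
    using S by (auto simp: grid_coclique_def)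
  moreover have "finite S" "card S = k" "(\<exists>x. \<forall>v\<in>S. fst v = x) \<or> (\<exists>y. \<forall>v\<in>S. snd v = y)"
    using S by (auto simp: grid_coclique_def)
  ultimately show ?thesis
    unfolding grid_coclique_def by (auto simp: card_image)
qed

lemma coclique_free_grid_transpose:
  assumes "coclique_free_grid k G"
  shows "coclique_free_grid k (transpose_grid G)"
  using assms by (auto simp: coclique_free_grid_def product_swap dest: grid_coclique_transpose)

definition agree_off_column :: "nat \<Rightarrow> grid_map \<Rightarrow> grid_map \<Rightarrow> bool" where
  "agree_off_column cs u v \<longleftrightarrow> (\<forall>x. x \<noteq> cs \<longrightarrow> fst u x = fst v x) \<and> snd u = snd v"

definition bridgeable :: "nat \<Rightarrow> nat \<Rightarrow> grid_graph \<Rightarrow> grid_map \<Rightarrow> grid_map \<Rightarrow> bool" where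
  "bridgeable cs y G u v \<longleftrightarrow> agree_off_column cs u v \<and> fst u cs \<noteq> fst v cs \<and>
     {(fst u cs, snd u y), (fst v cs, snd v y)} \<in> gedges G"

lemma agree_off_columnE:
  assumes "agree_off_column cs (f, g) v"
  obtains b where "v = (f(cs := b), g)"
proof
  show "v = (f(cs := fst v cs), g)"
    using assms by (auto simp: agree_off_column_def prod_eq_iff fun_eq_iff)
qed

lemma agree_off_column_eqI:
  assumes "agree_off_column cs u v" "fst u cs = fst v cs"
  shows "u = v"
proof (rule prod_eqI)
  show "fst u = fst v"
  proof
    fix x show "fst u x = fst v x"
      using assms by (cases "x = cs") (simp_all add: agree_off_column_def)
  qed
  show "snd u = snd v" using assms by (simp add: agree_off_column_def)
qed

lemma not_bridgeable_same [simp]: "\<not> bridgeable cs y G u u"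
  by (simp add: bridgeable_def)

lemma bridgeable_sym: "bridgeable cs y G u v \<Longrightarrow> bridgeable cs y G v u"
  by (auto simp: bridgeable_def agree_off_column_def insert_commute)

lemma fun_upd_eq_extensionalD:
  assumes "f \<in> extensional A" "g \<in> extensional A" "a \<notin> A" and upd: "f(a := b) = g(a := c)"
  shows "f = g" "b = c"
proof -
  have undef: "f a = undefined" "g a = undefined"
    by (rule extensional_arb[OF assms(1,3)], rule extensional_arb[OF assms(2,3)])
  have "f = (f(a := b))(a := f a)" by simp
  also have "\<dots> = (g(a := c))(a := g a)" by (simp only: upd undef)
  also have "\<dots> = g" by simp
  finally show "f = g" .
  from fun_cong[OF upd, of a] show "b = c" by simp
qed

definition bridge_embedding :: "nat \<Rightarrow> nat \<Rightarrow> grid_map \<times> grid_map \<Rightarrow> grid_map" where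
  "bridge_embedding n cs = (\<lambda>(u, v). ((fst u)(n := fst v cs), snd u))"

lemma bridge_embedding_mem_embeddings:
  assumes H: "grid_subgraph H" and cs: "cs \<in> {1..ncols H}"
    and u: "u \<in> embeddings H G" and v: "v \<in> embeddings H G" and uv: "bridgeable cs y G u v"
  shows "bridge_embedding (ncols H + 1) cs (u, v) \<in> embeddings (bridge_column cs y H) G"
proof -
  obtain f g where u_eq: "u = (f, g)" by (cases u)
  from uv have "agree_off_column cs (f, g) v" by (simp add: bridgeable_def u_eq)
  then obtain b where v_eq: "v = (f(cs := b), g)" by (rule agree_off_columnE)
  have "grid_embedding (bridge_column cs y H) G (f(ncols H + 1 := b)) g"
    using u v uv unfolding u_eq v_eq
    by (intro grid_embedding_bridge_column[OF H cs])
      (simp_all add: embeddings_def bridgeable_def)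
  moreover have "f(ncols H + 1 := b) \<in> extensional {1..ncols H + 1}"
    "g \<in> extensional {1..nrows H}"
    using u by (auto simp: u_eq embeddings_def extensional_def)
  ultimately show ?thesis by (simp add: bridge_embedding_def embeddings_def u_eq v_eq)
qed

lemma inj_on_bridge_embedding:
  "inj_on (bridge_embedding (ncols H + 1) cs)
    (SIGMA u : embeddings H G. {v \<in> embeddings H G. bridgeable cs y G u v})"
    (is "inj_on ?bridge ?pairs")
proof (rule inj_onI)
  fix w w' assume w: "w \<in> ?pairs" "w' \<in> ?pairs" and eq: "?bridge w = ?bridge w'"
  obtain f g v where w_eq: "w = ((f, g), v)" by (metis prod.exhaust)
  obtain f' g' v' where w'_eq: "w' = ((f', g'), v')" by (metis prod.exhaust)
  have upd: "f(ncols H + 1 := fst v cs) = f'(ncols H + 1 := fst v' cs)"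
    using eq by (simp add: bridge_embedding_def w_eq w'_eq)
  have ext: "f \<in> extensional {1..ncols H}" "f' \<in> extensional {1..ncols H}"
    using w by (simp_all add: w_eq w'_eq embeddings_def)
  have "f = f'" "fst v cs = fst v' cs"
    by (rule fun_upd_eq_extensionalD[OF ext _ upd]; simp)+
  moreover have "g = g'" using eq by (simp add: bridge_embedding_def w_eq w'_eq)
  moreover have "agree_off_column cs (f, g) v" "agree_off_column cs (f', g') v'"
    using w by (simp_all add: w_eq w'_eq bridgeable_def)
  ultimately show "w = w'"
    unfolding w_eq w'_eq by (elim agree_off_columnE) simp
qed

lemma card_bridgeable_pairs_le:
  assumes "grid_subgraph H" "cs \<in> {1..ncols H}"
  shows "card (SIGMA u : embeddings H G. {v \<in> embeddings H G. bridgeable cs y G u v})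
    \<le> card (embeddings (bridge_column cs y H) G)"
proof (rule card_inj_on_le[OF inj_on_bridge_embedding _ finite_embeddings])
  show "bridge_embedding (ncols H + 1) cs `
      (SIGMA u : embeddings H G. {v \<in> embeddings H G. bridgeable cs y G u v})
    \<subseteq> embeddings (bridge_column cs y H) G"
    using bridge_embedding_mem_embeddings[OF assms] by blast
qed

subsection \<open>Counting embeddings\<close>

lemma card_le_card_mult_fibre_bound:
  assumes "finite S" "finite P" "f ` S \<subseteq> P" and "\<And>p. p \<in> P \<Longrightarrow> card {u \<in> S. f u = p} \<le> k"
  shows "card S \<le> card P * k"
proof -
  have "card S = (\<Sum>p\<in>P. card {u \<in> S. f u = p})"
    using sum.group[OF assms(1-3), of "\<lambda>_. 1 :: nat"] by simp
  also have "\<dots> \<le> card P * k" using sum_bounded_above[of P _ k] assms(4) by simp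
  finally show ?thesis .
qed

lemma grid_coclique_if_no_bridgeable_pair:
  assumes G: "gverts G = {1..ncols G} \<times> {1..nrows G}"
    and cs: "cs \<in> {1..ncols H}" and y: "y \<in> {1..nrows H}"
    and F: "F \<subseteq> embeddings H G" and agree: "\<And>u v. u \<in> F \<Longrightarrow> v \<in> F \<Longrightarrow> agree_off_column cs u v"
    and indep: "pairwise (\<lambda>u v. \<not> bridgeable cs y G u v) F"
  shows "grid_coclique G (card F) ((\<lambda>u. (fst u cs, snd u y)) ` F)"
  unfolding grid_coclique_def
proof (intro conjI)
  let ?pos = "\<lambda>u. (fst u cs, snd u y)"
  show "?pos ` F \<subseteq> gverts G"
  proof (rule image_subsetI)
    fix u assume "u \<in> F"
    then have "u \<in> embeddings H G" using F by blast
    then have "fst u cs \<in> {1..ncols G}" "snd u y \<in> {1..nrows G}"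
      using embeddings_range cs y by blast+
    then show "?pos u \<in> gverts G" by (simp add: G)
  qed
  show "finite (?pos ` F)" using finite_subset[OF F finite_embeddings] by simp
  have "inj_on ?pos F" using agree by (intro inj_onI agree_off_column_eqI[of cs]) simp_all
  then show "card (?pos ` F) = card F" by (rule card_image)
  have "{?pos u, ?pos v} \<notin> gedges G" if uv: "u \<in> F" "v \<in> F" "?pos u \<noteq> ?pos v" for u v
  proof
    assume "{?pos u, ?pos v} \<in> gedges G"
    then have "bridgeable cs y G u v"
      using agree[OF uv(1,2)] uv(3) by (auto simp: bridgeable_def agree_off_column_def)
    with indep uv show False by (auto simp: pairwise_def)
  qed
  then show "\<forall>p\<in>?pos ` F. \<forall>q\<in>?pos ` F. p \<noteq> q \<longrightarrow> {p, q} \<notin> gedges G" by blast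
  have "snd u y = snd v y" if "u \<in> F" "v \<in> F" for u v
    using agree[OF that] by (simp add: agree_off_column_def)
  then have "\<exists>b. \<forall>u\<in>F. snd u y = b" by blast
  then have "\<exists>b. \<forall>p\<in>?pos ` F. snd p = b" by simp
  then show "(\<exists>a. \<forall>p\<in>?pos ` F. fst p = a) \<or> (\<exists>b. \<forall>p\<in>?pos ` F. snd p = b)" ..
qed

lemma card_le_if_no_bridgeable_pair:
  assumes G: "coclique_free_grid k G" and "cs \<in> {1..ncols H}" "y \<in> {1..nrows H}"
    and "F \<subseteq> embeddings H G" "\<And>u v. u \<in> F \<Longrightarrow> v \<in> F \<Longrightarrow> agree_off_column cs u v"
    and "pairwise (\<lambda>u v. \<not> bridgeable cs y G u v) F"
  shows "card F \<le> k"
proof (rule ccontr)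
  assume "\<not> card F \<le> k"
  then have "k \<le> card F" by simp
  moreover have "gverts G = {1..ncols G} \<times> {1..nrows G}"
    using G by (simp add: coclique_free_grid_def)
  then have "grid_coclique G (card F) ((\<lambda>u. (fst u cs, snd u y)) ` F)"
    using assms(2-) by (rule grid_coclique_if_no_bridgeable_pair)
  ultimately show False using G grid_coclique_shrink by (auto simp: coclique_free_grid_def)
qed

lemma card_independent_embeddings_le:
  assumes G: "coclique_free_grid k G" and cs: "cs \<in> {1..ncols H}" and y: "y \<in> {1..nrows H}"
    and S: "S \<subseteq> embeddings H G" and indep: "pairwise (\<lambda>u v. \<not> bridgeable cs y G u v) S"
  shows "card S \<le> ncols G ^ (ncols H - 1) * nrows G ^ nrows H * k"
proof -
  define P where
    "P = (({1..ncols H} - {cs}) \<rightarrow>\<^sub>E {1..ncols G}) \<times> ({1..nrows H} \<rightarrow>\<^sub>E {1..nrows G})"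
  define forget :: "grid_map \<Rightarrow> grid_map" where "forget u = ((fst u)(cs := undefined), snd u)" for u
  have "card P = ncols G ^ (ncols H - 1) * nrows G ^ nrows H"
    using cs by (simp add: P_def card_cartesian_product card_PiE)
  moreover have "card S \<le> card P * k"
  proof (rule card_le_card_mult_fibre_bound)
    show "finite S" by (rule finite_subset[OF S finite_embeddings])
    show "finite P" by (simp add: P_def finite_PiE)
    show "forget ` S \<subseteq> P"
    proof (rule image_subsetI)
      fix u assume "u \<in> S"
      then have "u \<in> ({1..ncols H} \<rightarrow>\<^sub>E {1..ncols G}) \<times> ({1..nrows H} \<rightarrow>\<^sub>E {1..nrows G})"
        using S embeddings_subset by blast
      then show "forget u \<in> P"
        by (auto simp: P_def forget_def PiE_def Pi_def extensional_def)
    qed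
    fix p assume "p \<in> P"
    have "agree_off_column cs u v" if "forget u = forget v" for u v
      using that by (auto simp: forget_def agree_off_column_def fun_eq_iff split: if_splits)
    then show "card {u \<in> S. forget u = p} \<le> k"
      using S indep by (intro card_le_if_no_bridgeable_pair[OF G cs y]) (auto simp: pairwise_def)
  qed
  ultimately show ?thesis by simp
qed

lemma card_embeddings_bridge_column:
  assumes G: "coclique_free_grid k G" and H: "grid_subgraph H"
    and cs: "cs \<in> {1..ncols H}" and y: "y \<in> {1..nrows H}"
  shows "(real (card (embeddings H G)))\<^sup>2 \<le> real (ncols G ^ (ncols H - 1) * nrows G ^ nrows H * k) *
    (real (card (embeddings (bridge_column cs y H) G)) + real (card (embeddings H G)))"
proof -
  let ?E = "embeddings H G" and ?m = "ncols G ^ (ncols H - 1) * nrows G ^ nrows H * k"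
  define R where "R u v \<longleftrightarrow> u = v \<or> bridgeable cs y G u v" for u v
  have "closed_nbhd R ?E u = insert u {v \<in> ?E. bridgeable cs y G u v}" if "u \<in> ?E" for u
    using that by (auto simp: closed_nbhd_def R_def)
  then have "(\<Sum>u\<in>?E. card (closed_nbhd R ?E u))
      = (\<Sum>u\<in>?E. Suc (card {v \<in> ?E. bridgeable cs y G u v}))"
    using finite_embeddings by (intro sum.cong) simp_all
  also have "\<dots> = card (SIGMA u : ?E. {v \<in> ?E. bridgeable cs y G u v}) + card ?E"
    using finite_embeddings by (simp add: sum_Suc)
  also have "\<dots> \<le> card (embeddings (bridge_column cs y H) G) + card ?E"
    using card_bridgeable_pairs_le[OF H cs] by simp
  finally have degrees: "(\<Sum>u\<in>?E. card (closed_nbhd R ?E u))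
      \<le> card (embeddings (bridge_column cs y H) G) + card ?E" .
  have "(real (card ?E))\<^sup>2 \<le> real ?m * (\<Sum>u\<in>?E. real (card (closed_nbhd R ?E u)))"
  proof (rule Turan_card_power2_le)
    show "reflp_on ?E R" by (simp add: reflp_on_def R_def)
    show "symp_on ?E R" by (auto simp: symp_on_def R_def bridgeable_sym)
    fix S assume "S \<subseteq> ?E" "pairwise (\<lambda>u v. \<not> R u v) S"
    then show "card S \<le> ?m"
      by (intro card_independent_embeddings_le[OF G cs y]) (auto simp: R_def pairwise_def)
  qed (rule finite_embeddings)
  also have "\<dots> \<le> real ?m * real (card (embeddings (bridge_column cs y H) G) + card ?E)"
    using degrees by (intro mult_left_mono) (simp_all flip: of_nat_sum)
  finally show ?thesis by simp
qed

definition embedding_density :: "grid_graph \<Rightarrow> grid_graph \<Rightarrow> real" where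
  "embedding_density H G =
     real (card (embeddings H G)) / (real (ncols G) ^ ncols H * real (nrows G) ^ nrows H)"

lemma embedding_density_transpose:
  "embedding_density (transpose_grid H) (transpose_grid G) = embedding_density H G"
  by (simp add: embedding_density_def card_embeddings_transpose mult.commute)

lemma embedding_density_bridge_column:
  assumes G: "coclique_free_grid k G" and pos: "0 < ncols G" "0 < nrows G"
    and H: "grid_subgraph H" and cs: "cs \<in> {1..ncols H}" and y: "y \<in> {1..nrows H}"
  shows "(embedding_density H G)\<^sup>2 \<le> real k *
    (embedding_density (bridge_column cs y H) G + embedding_density H G / real (ncols G))"
proof -
  define T where "T = real (card (embeddings H G))"
  define T' where "T' = real (card (embeddings (bridge_column cs y H) G))"
  define a where "a = real (ncols G)"
  define C where "C = a ^ (ncols H - 1) * real (nrows G) ^ nrows H"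
  have "0 < a" "0 < C" using pos by (simp_all add: a_def C_def)
  have "a ^ ncols H = a * a ^ (ncols H - 1)" using cs by (simp add: power_eq_if)
  then have density: "embedding_density H G = T / (C * a)"
    "embedding_density (bridge_column cs y H) G = T' / (C * a\<^sup>2)"
    by (simp_all add: embedding_density_def T_def T'_def C_def a_def power2_eq_square mult_ac)
  have "T\<^sup>2 \<le> C * (real k * (T' + T))"
    using card_embeddings_bridge_column[OF G H cs y]
    by (simp add: T_def T'_def C_def a_def mult_ac)
  then have "T\<^sup>2 / (C * a)\<^sup>2 \<le> C * (real k * (T' + T)) / (C * a)\<^sup>2"
    by (rule divide_right_mono) simp
  also have "\<dots> = real k * (T' / (C * a\<^sup>2) + T / (C * a) / a)"
    using \<open>0 < a\<close> \<open>0 < C\<close> by (simp add: field_simps power2_eq_square)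
  finally show ?thesis unfolding density by (simp add: power_divide a_def)
qed

lemma embedding_density_bridge_row:
  assumes G: "coclique_free_grid k G" and pos: "0 < ncols G" "0 < nrows G"
    and H: "grid_subgraph H" and rs: "rs \<in> {1..nrows H}" and x: "x \<in> {1..ncols H}"
  shows "(embedding_density H G)\<^sup>2 \<le> real k *
    (embedding_density (bridge_row rs x H) G + embedding_density H G / real (nrows G))"
proof -
  have "embedding_density (bridge_column rs x (transpose_grid H)) (transpose_grid G) =
      embedding_density (bridge_row rs x H) G"
    using embedding_density_transpose[of "bridge_row rs x H" G]
    by (simp add: bridge_row_eq_transpose)
  then show ?thesis
    using embedding_density_bridge_column[OF coclique_free_grid_transpose[OF G] _ _
        grid_subgraph_transpose[OF H], of rs x] pos rs x
    by (simp add: embedding_density_transpose)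
qed

lemma embedding_density_single_vertex:
  assumes "0 < ncols G" "0 < nrows G"
  shows "embedding_density single_vertex G = 1"
proof -
  have "embeddings single_vertex G = ({1} \<rightarrow>\<^sub>E {1..ncols G}) \<times> ({1} \<rightarrow>\<^sub>E {1..nrows G})"
    by (auto simp: embeddings_def grid_embedding_def single_vertex_def PiE_def)
  then have "card (embeddings single_vertex G) = ncols G * nrows G"
    by (simp add: card_cartesian_product card_PiE)
  with assms show ?thesis by (simp add: embedding_density_def single_vertex_def)
qed

lemma density_recurrence_lower_bound:
  fixes k d d' \<delta> M :: real
  assumes rec: "d\<^sup>2 \<le> k * (d' + d / M)" and pos: "0 < k" "0 < \<delta>"
    and d: "\<delta> \<le> d" and M: "2 * k / \<delta> \<le> M"
  shows "\<delta>\<^sup>2 / (2 * k) \<le> d'"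
proof -
  have "0 < d" using pos d by simp
  have "0 < M" using pos M by (intro less_le_trans[OF _ M]) simp
  have "2 * k \<le> M * \<delta>" using M pos by (simp add: field_simps)
  also have "\<dots> \<le> M * d" using d \<open>0 < M\<close> by simp
  finally have "2 * k * d \<le> M * d\<^sup>2" using \<open>0 < d\<close> by (simp add: power2_eq_square)
  then have "k * (d / M) \<le> d\<^sup>2 / 2" using \<open>0 < M\<close> by (simp add: field_simps)
  with rec have "d\<^sup>2 \<le> 2 * k * d'" unfolding distrib_left by linarith
  then have "d\<^sup>2 / (2 * k) \<le> d'" using pos by (simp add: field_simps)
  moreover have "\<delta>\<^sup>2 / (2 * k) \<le> d\<^sup>2 / (2 * k)"
    using pos d by (intro divide_right_mono power_mono) simp_all
  ultimately show ?thesis by simp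
qed

lemma density_recurrence_doubling:
  fixes d d' :: real and k n M :: nat
  assumes rec: "d\<^sup>2 \<le> real k * (d' + d / real M)" and k: "0 < k" and n: "2 \<le> n"
    and M: "(2 * k) ^ 2 ^ (n - 2) \<le> M" and d: "2 * real k / (2 * real k) ^ 2 ^ (n - 2) \<le> d"
  shows "2 * real k / (2 * real k) ^ 2 ^ (n - 1) \<le> d'"
proof -
  let ?q = "(2 * real k) ^ 2 ^ (n - 2)"
  have "n - 1 = Suc (n - 2)" using n by simp
  then have q2: "(2 * real k) ^ 2 ^ (n - 1) = ?q\<^sup>2" by (simp only: power_Suc2 power_mult)
  have "real ((2 * k) ^ 2 ^ (n - 2)) \<le> real M" using M by (rule of_nat_mono)
  then have "?q \<le> real M" by simp
  have "2 * real k / ?q\<^sup>2 = (2 * real k / ?q)\<^sup>2 / (2 * real k)"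
    using k by (simp add: power2_eq_square)
  also have "\<dots> \<le> d'"
    using k \<open>?q \<le> real M\<close> by (intro density_recurrence_lower_bound[OF rec _ _ d]) simp_all
  finally show ?thesis by (simp only: q2)
qed

lemma embedding_density_bridged_ge:
  assumes G: "coclique_free_grid k G" and k: "0 < k"
    and size: "(2 * k) ^ 2 ^ m \<le> ncols G" "(2 * k) ^ 2 ^ m \<le> nrows G"
    and H: "bridged H" "ncols H + nrows H \<le> m + 3"
  shows "2 * real k / (2 * real k) ^ 2 ^ (ncols H + nrows H - 2) \<le> embedding_density H G"
proof -
  have "0 < (2 * k) ^ 2 ^ m" using k by simp
  with size have pos: "0 < ncols G" "0 < nrows G" by linarith+
  have "(2 * k) ^ 2 ^ i \<le> (2 * k) ^ 2 ^ m" if "i \<le> m" for i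
    using k that by (intro power_increasing) simp_all
  with size have size_le: "(2 * k) ^ 2 ^ i \<le> ncols G" "(2 * k) ^ 2 ^ i \<le> nrows G"
    if "i \<le> m" for i
    using that order_trans by blast+
  from H show ?thesis
  proof (induction rule: bridged.induct)
    case base
    from embedding_density_single_vertex[OF pos] show ?case
      using k by (simp add: single_vertex_def)
  next
    case (column H cs y)
    have n: "2 \<le> ncols H + nrows H" using bridged_dims_pos[OF column.hyps(1)] by simp
    have "2 * real k / (2 * real k) ^ 2 ^ (ncols H + nrows H - 1)
        \<le> embedding_density (bridge_column cs y H) G"
      using column.prems n
      by (intro density_recurrence_doubling[OF embedding_density_bridge_column[OF G pos
            bridged_grid_subgraph[OF column.hyps(1)] column.hyps(2,3)]] k size_le column.IH)
        simp_all
    then show ?case by simp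
  next
    case (row H rs x)
    have n: "2 \<le> ncols H + nrows H" using bridged_dims_pos[OF row.hyps(1)] by simp
    have "2 * real k / (2 * real k) ^ 2 ^ (ncols H + nrows H - 1)
        \<le> embedding_density (bridge_row rs x H) G"
      using row.prems n
      by (intro density_recurrence_doubling[OF embedding_density_bridge_row[OF G pos
            bridged_grid_subgraph[OF row.hyps(1)] row.hyps(2,3)]] k size_le row.IH)
        simp_all
    then show ?case by simp
  qed
qed

subsection \<open>Ramsey numbers\<close>

lemma spanning_grid_subgraphD:
  assumes "spanning_grid_subgraph N G"
  shows "ncols G = N" "nrows G = N" "gverts G = {1..N} \<times> {1..N}"
  using assms by (simp_all add: spanning_grid_subgraph_def complete_grid_def)

lemma bridged_ramsey_property:
  assumes H: "bridged H" and k: "0 < k"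
  shows "grid_ramsey_property H k ((2 * k) ^ 2 ^ (ncols H + nrows H - 3))"
  unfolding grid_ramsey_property_def
proof (intro allI impI)
  let ?N = "(2 * k) ^ 2 ^ (ncols H + nrows H - 3)"
  fix G assume "spanning_grid_subgraph ?N G"
  note G = spanning_grid_subgraphD[OF this]
  show "grid_contains G H \<or> (\<exists>S. grid_coclique G k S)"
  proof (rule disjCI)
    assume "\<nexists>S. grid_coclique G k S"
    with G have free: "coclique_free_grid k G" by (simp add: coclique_free_grid_def)
    have "0 < 2 * real k / (2 * real k) ^ 2 ^ (ncols H + nrows H - 2)" using k by simp
    also have "\<dots> \<le> embedding_density H G"
      by (rule embedding_density_bridged_ge[OF free k _ _ H, where m = "ncols H + nrows H - 3"])
        (simp_all add: G)
    finally have "embeddings H G \<noteq> {}" by (auto simp: embedding_density_def)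
    then show "grid_contains G H" by (auto simp: embeddings_def grid_contains_def)
  qed
qed

lemma grid_ramsey_property_single_vertex:
  assumes "0 < N"
  shows "grid_ramsey_property single_vertex k N"
proof -
  have "grid_embedding single_vertex G id id" if "spanning_grid_subgraph N G" for G
    using assms spanning_grid_subgraphD(1,2)[OF that]
    by (auto simp: grid_embedding_def single_vertex_def)
  then show ?thesis by (auto simp: grid_ramsey_property_def grid_contains_def)
qed

lemma grid_ramsey_property_one_coclique:
  assumes "0 < N"
  shows "grid_ramsey_property H 1 N"
proof -
  have "grid_coclique G 1 {(1, 1)}" if "spanning_grid_subgraph N G" for G
    using assms spanning_grid_subgraphD(3)[OF that] by (auto simp: grid_coclique_def)
  then show ?thesis unfolding grid_ramsey_property_def by blast
qed

lemma bridged_eq_single_vertex_or_dims_ge_3: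
  assumes "bridged H"
  shows "H = single_vertex \<or> 3 \<le> nrows H + ncols H"
  using assms
proof cases
  case (column H0 cs y)
  then show ?thesis using bridged_dims_pos[of H0] by simp
next
  case (row H0 rs x)
  then show ?thesis using bridged_dims_pos[of H0] by simp
qed simp

lemma grid_embedding_comp:
  assumes fg: "grid_embedding K G f g" and fg': "grid_embedding H K f' g'"
  shows "grid_embedding H G (f \<circ> f') (g \<circ> g')"
proof -
  have inj: "inj_on f {1..ncols K}" "inj_on g {1..nrows K}"
      "inj_on f' {1..ncols H}" "inj_on g' {1..nrows H}"
    and f_range: "f ` {1..ncols K} \<subseteq> {1..ncols G}" and g_range: "g ` {1..nrows K} \<subseteq> {1..nrows G}"
    and f'_range: "f' ` {1..ncols H} \<subseteq> {1..ncols K}"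
    and g'_range: "g' ` {1..nrows H} \<subseteq> {1..nrows K}"
    using fg fg' by (simp_all add: grid_embedding_def)
  have "inj_on (f \<circ> f') {1..ncols H}" "inj_on (g \<circ> g') {1..nrows H}"
    using comp_inj_on[OF inj(3) inj_on_subset[OF inj(1) f'_range]]
      comp_inj_on[OF inj(4) inj_on_subset[OF inj(2) g'_range]] .
  moreover have "(f \<circ> f') ` {1..ncols H} \<subseteq> {1..ncols G}"
    using f_range f'_range unfolding image_comp[symmetric] by blast
  moreover have "(g \<circ> g') ` {1..nrows H} \<subseteq> {1..nrows G}"
    using g_range g'_range unfolding image_comp[symmetric] by blast
  ultimately show ?thesis using fg fg' by (simp add: grid_embedding_def)
qed

lemma grid_contains_trans: "grid_contains G K \<Longrightarrow> grid_contains K H \<Longrightarrow> grid_contains G H"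
  unfolding grid_contains_def using grid_embedding_comp by blast

lemma grid_relabeling_imp_grid_contains:
  assumes H: "grid_subgraph H" and rel: "grid_relabeling H H'"
  shows "grid_contains H H'"
proof -
  obtain p q where dims: "ncols H' = ncols H" "nrows H' = nrows H"
    and p: "bij_betw p {1..ncols H} {1..ncols H}" and q: "bij_betw q {1..nrows H} {1..nrows H}"
    and edges: "gedges H' = (\<lambda>e. map_prod p q ` e) ` gedges H"
    using rel unfolding grid_relabeling_def by blast
  let ?p = "inv_into {1..ncols H} p" and ?q = "inv_into {1..nrows H} q"
  have "map_prod ?p ?q ` e' \<in> gedges H" if e': "e' \<in> gedges H'" for e'
  proof -
    obtain e where e: "e \<in> gedges H" "e' = map_prod p q ` e" using e' unfolding edges by blast
    obtain a b a' b' where "e = {(a, b), (a', b')}"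
      "a \<in> {1..ncols H}" "b \<in> {1..nrows H}" "a' \<in> {1..ncols H}" "b' \<in> {1..nrows H}"
      using gedgesE[OF H e(1)] by metis
    then have "map_prod ?p ?q ` e' = e"
      by (simp add: e(2) bij_betw_inv_into_left[OF p] bij_betw_inv_into_left[OF q]
          del: atLeastAtMost_iff One_nat_def)
    with e(1) show ?thesis by simp
  qed
  moreover have "bij_betw ?p {1..ncols H} {1..ncols H}" "bij_betw ?q {1..nrows H} {1..nrows H}"
    using p q by (auto intro: bij_betw_inv_into)
  ultimately have "grid_embedding H' H ?p ?q"
    by (intro grid_embeddingI) (auto simp only: dims bij_betw_def)
  then show ?thesis by (auto simp: grid_contains_def)
qed

lemma grid_ramsey_property_mono:
  assumes "grid_contains K H" "grid_ramsey_property K k N"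
  shows "grid_ramsey_property H k N"
  using assms grid_contains_trans unfolding grid_ramsey_property_def by blast

lemma gr_le: "grid_ramsey_property H k N \<Longrightarrow> gr H k \<le> N"
  unfolding gr_def by (rule Least_le)

definition gr_bound :: "nat \<Rightarrow> nat \<Rightarrow> real" where
  "gr_bound n k = 2 powr (2 ^ n - 2) * real k powr (2 powr (real n - 3))"

lemma one_le_gr_bound:
  assumes "1 \<le> n" "1 \<le> k"
  shows "1 \<le> gr_bound n k"
proof -
  have "(2 :: real) ^ 1 \<le> 2 ^ n" using assms(1) by (intro power_increasing) simp_all
  then have "1 * 1 \<le> gr_bound n k"
    unfolding gr_bound_def using assms(2) by (intro mult_mono ge_one_powr_ge_zero) simp_all
  then show ?thesis by simp
qed

lemma double_power_le_gr_bound: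
  assumes n: "3 \<le> n" and k: "1 \<le> k"
  shows "real ((2 * k) ^ 2 ^ (n - 3)) \<le> gr_bound n k"
proof -
  have "real n - 3 = real (n - 3)" using n by simp
  then have exp_k: "2 powr (real n - 3) = real (2 ^ (n - 3))"
    by (simp only: powr_realpow of_nat_power of_nat_numeral zero_less_numeral)
  have "(2 :: real) ^ n = 8 * 2 ^ (n - 3)" using power_add[of "2 :: real" 3 "n - 3"] n by simp
  moreover have "(1 :: real) \<le> 2 ^ (n - 3)" by simp
  ultimately have exp_2: "real (2 ^ (n - 3)) \<le> 2 ^ n - 2"
    unfolding of_nat_power of_nat_numeral by linarith
  have "real ((2 * k) ^ m) = 2 powr real m * real k powr real m" for m
    using k by (simp add: power_mult_distrib powr_realpow)
  then have "real ((2 * k) ^ 2 ^ (n - 3)) =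
      2 powr real (2 ^ (n - 3)) * real k powr real (2 ^ (n - 3))" .
  also have "\<dots> \<le> 2 powr (2 ^ n - 2) * real k powr real (2 ^ (n - 3))"
    using exp_2 by (intro mult_right_mono powr_mono) auto
  finally show ?thesis by (simp only: gr_bound_def exp_k)
qed

lemma gr_bound_le_powr:
  assumes "2 \<le> k"
  shows "gr_bound n k \<le> real k powr (2 * 2 ^ n)"
proof -
  have "(2 :: real) powr (2 ^ n - 2) \<le> 2 powr (2 ^ n)" by (intro powr_mono) auto
  also have "\<dots> \<le> real k powr (2 ^ n)" using assms by (intro powr_mono2) auto
  finally have factor_2: "2 powr (2 ^ n - 2) \<le> real k powr (2 ^ n)" .
  have "(2 :: real) powr (real n - 3) \<le> 2 powr real n" by (intro powr_mono) auto
  then have "(2 :: real) powr (real n - 3) \<le> 2 ^ n"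
    by (simp only: powr_realpow zero_less_numeral)
  then have factor_k: "real k powr (2 powr (real n - 3)) \<le> real k powr (2 ^ n)"
    using assms by (intro powr_mono) auto
  have "gr_bound n k \<le> real k powr (2 ^ n) * real k powr (2 ^ n)"
    unfolding gr_bound_def using factor_2 factor_k by (intro mult_mono) auto
  also have "\<dots> = real k powr (2 * 2 ^ n)" by (simp flip: powr_add)
  finally show ?thesis .
qed

text \<open>The single vertex needs its own case: the truncated exponent \<open>2 - 3 = 0\<close> gives \<open>N = 2 k\<close>
  there, which exceeds the bound \<open>4 * sqrt k\<close> once \<open>k > 4\<close>.\<close>

lemma bridging_constructible_ramsey_property:
  assumes H: "bridging_constructible H" and k: "1 \<le> k"
  obtains N where "grid_ramsey_property H k N" "real N \<le> gr_bound (nrows H + ncols H) k"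
proof -
  obtain H0 where H0: "bridged H0" and rel: "grid_relabeling H0 H"
    using H by (auto simp: bridging_constructible_def)
  have dims: "nrows H0 + ncols H0 = nrows H + ncols H"
    using rel by (simp add: grid_relabeling_def)
  note ramsey = grid_ramsey_property_mono[OF
      grid_relabeling_imp_grid_contains[OF bridged_grid_subgraph[OF H0] rel]]
  from bridged_eq_single_vertex_or_dims_ge_3[OF H0] show thesis
  proof
    assume "H0 = single_vertex"
    then have "grid_ramsey_property H k 1"
      using ramsey grid_ramsey_property_single_vertex[of 1 k] by simp
    moreover have "1 \<le> nrows H + ncols H" using bridged_dims_pos[OF H0] dims by simp
    ultimately show thesis using one_le_gr_bound[OF _ k] by (intro that[of 1]) simp_all
  next
    assume "3 \<le> nrows H0 + ncols H0"
    then have n: "3 \<le> nrows H + ncols H" by (simp only: dims)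
    have "grid_ramsey_property H k ((2 * k) ^ 2 ^ (nrows H + ncols H - 3))"
      using ramsey bridged_ramsey_property[OF H0, of k] k dims by (simp add: add.commute)
    then show thesis using double_power_le_gr_bound[OF n k] by (rule that)
  qed
qed

lemma bridging_constructible_gr_le:
  assumes "bridging_constructible H" "1 \<le> k"
  shows "(\<exists>N. grid_ramsey_property H k N) \<and> real (gr H k) \<le> gr_bound (nrows H + ncols H) k"
proof -
  obtain N where N: "grid_ramsey_property H k N" "real N \<le> gr_bound (nrows H + ncols H) k"
    using bridging_constructible_ramsey_property[OF assms] .
  moreover have "real (gr H k) \<le> real N" using gr_le[OF N(1)] by simp
  ultimately show ?thesis by auto
qed

lemma bridging_constructible_gr_le_powr:
  assumes H: "bridging_constructible H" and k: "1 \<le> k"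
  shows "real (gr H k) \<le> real k powr (2 * 2 ^ (nrows H + ncols H))"
proof (cases "k = 1")
  case True
  then show ?thesis using gr_le[OF grid_ramsey_property_one_coclique[of 1 H]] by simp
next
  case False
  with k have "2 \<le> k" by simp
  with bridging_constructible_gr_le[OF H k] gr_bound_le_powr show ?thesis
    by (blast intro: order_trans)
qed

theorem theorem3p3:
  "(\<exists>C::real. C > 0 \<and>
      (\<forall>(H::grid_graph) (k::nat) (r::nat) (c::nat).
        grid_subgraph H \<and> nrows H = r \<and> ncols H = c \<and> bridging_constructible H \<and> k \<ge> 1 \<longrightarrow>
          real (gr H k) \<le> real k powr (C * 2 ^ (r + c)))) \<and>
   (\<forall>(H::grid_graph) (k::nat) (r::nat) (c::nat).
      grid_subgraph H \<and> nrows H = r \<and> ncols H = c \<and> bridging_constructible H \<and> k \<ge> 1 \<longrightarrow>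
        (\<exists>N. grid_ramsey_property H k N) \<and>
        real (gr H k) \<le>
          2 powr (2 ^ (r + c) - 2) * real k powr (2 powr (real (r + c) - 3)))"
    (is "?asymptotic \<and> ?explicit")
proof
  show ?asymptotic
    using bridging_constructible_gr_le_powr by (intro exI[of _ 2]) auto
  show ?explicit
    using bridging_constructible_gr_le unfolding gr_bound_def by blast
qed

end
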